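(* Let $p, q \in \mathcal{G}$, let $\bar S_p=[a,b]$ be the closure of the support of $p$, and let $Q(b) = \int_a^b q(u)\,du$. Then $\int_{-\infty}^{+\infty} \mathcal{T}_p f(y)\, q(y)\, dy=0$ for all $f \in \mathcal{F}(p)$ if, and only if, $q(x)=p(x)\,Q(b)$ for all $x \in S_p$.
   Context: $\mathcal{G}$ is the collection of positive real functions $x\mapsto p(x)$ such that (i) the support $S_p := \{x \in \mathbb{R} : p(x) \text{ (exists and) is positive}\}$ is an interval with closure $\bar S_p=[a,b]$ for some $-\infty\le a<b\le\infty$; (ii) $p$ is differentiable (in the usual sense) at every point of $(a,b)$, with derivative $p'$; (iii) $\int_{S_p}p(y)\,dy=1$. Thus each $p\in\mathcal{G}$ is the density with respect to Lebesgue measure of an absolutely continuous random variable. Convention: $\frac{1}{p(x)}$ is understood to be $0$ when $x\notin S_p$ (so $p(x)/p(x)=\mathbb{I}_{S_p}(x)$, the indicator function of $S_p$). For $p\in\mathcal{G}$ with $\bar S_p=[a,b]$, the class of test functions $\mathcal{F}(p)$ is the collection of functions $f:\mathbb{R}\to\mathbb{R}$ such that $x\mapsto f(x)p(x)$ is differentiable on the interior of $S_p$ and $f(a^+)p(a^+)=f(b^-)p(b^-)=0$ (that is, $f(x)p(x)\to 0$ as $x\to a^+$ and as $x\to b^-$). The Stein operator $\mathcal{T}_p$ maps $f\in\mathcal{F}(p)$ to the function $\mathcal{T}_pf:\mathbb{R}\to\mathbb{R}$, $\mathcal{T}_pf(x):=\frac{1}{p(x)}\left.\frac{d}{dy}(f(y)p(y))\right|_{y=x}$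 (hence $\mathcal{T}_pf(x)=0$ for $x\notin S_p$).
   Formalization: The equality q(x)=p(x)Q(b) is stated for x in the interior of S_p, since values of p and q at endpoints belonging to S_p are unconstrained and it can fail there; integrals are Henstock–Kurzweil, as T_p f·q need not be Lebesgue integrable. *)

theory Defs
  imports "HOL-Analysis.Analysis"
begin

definition density_support :: "(real \<Rightarrow> real) \<Rightarrow> real set" where
  "density_support p = {x. 0 < p x}"

(* The closure of the support is [a,b] intersected with the real line; a and b are
   extended reals, uniquely determined by p. *)
definition support_endpoints :: "(real \<Rightarrow> real) \<Rightarrow> ereal \<Rightarrow> ereal \<Rightarrow> bool" where
  "support_endpoints p a b \<longleftrightarrow>
     a < b \<and> closure (density_support p) = {x. a \<le> ereal x \<and> ereal x \<le> b}"

(* The class G.  Points where a density "does not exist" carry the value 0.  The values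
   at finite endpoints of the support are unconstrained apart from nonnegativity. *)
definition density_class :: "(real \<Rightarrow> real) set" where
  "density_class =
     {p. (\<forall>x. 0 \<le> p x) \<and>
         is_interval (density_support p) \<and>
         (\<exists>a b. support_endpoints p a b \<and>
                (\<forall>x. a < ereal x \<and> ereal x < b \<longrightarrow> p differentiable (at x))) \<and>
         (p has_integral 1) (density_support p)}"

(* The class F(p).  The boundary conditions are one-sided limits on the extended reals, so
   they are limits at infinity when a = -\<infinity> or b = \<infinity>. *)
definition stein_class :: "(real \<Rightarrow> real) \<Rightarrow> (real \<Rightarrow> real) set" where
  "stein_class p =
     {f. (\<forall>x \<in> interior (density_support p). (\<lambda>y. f y * p y) differentiable (at x)) \<and>
         (\<exists>a b. support_endpoints p a b \<and>
                (((\<lambda>y. f y * p y) \<circ> real_of_ereal) \<longlongrightarrow> 0) (at_right a) \<and>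
                (((\<lambda>y. f y * p y) \<circ> real_of_ereal) \<longlongrightarrow> 0) (at_left b))}"

(* Division by zero gives 0 in HOL, which is the convention 1/p(x) = 0 off the support for
   p in the class G.  The value of deriv is only meaningful on the interior of the support;
   the remaining points of the support are at most its two endpoints. *)
definition stein_operator :: "(real \<Rightarrow> real) \<Rightarrow> (real \<Rightarrow> real) \<Rightarrow> real \<Rightarrow> real" where
  "stein_operator p f x = 1 / p x * deriv (\<lambda>y. f y * p y) x"

end

theory Submission
  imports Defs
begin

text \<open>
  Write \<open>I\<close> for the interior of the support of \<open>p\<close>, so \<open>I = (a, b)\<close> up to the embedding into the
  extended reals. The remaining points of the support form a null set.

  Suppose \<open>q = c p\<close> on \<open>I\<close>. Multiplying by \<open>q\<close> cancels the factor \<open>1 / p\<close> of the Stein operator, and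
  the integrand becomes \<open>c (f p)'\<close>. Its integral is the difference of the boundary values of \<open>f p\<close>,
  which vanish. Nothing makes \<open>(f p)'\<close> absolutely integrable, so the gauge integral is essential here:
  extended by zero, \<open>f p\<close> is continuous on the whole line and tends to zero at both infinities, and the
  fundamental theorem holds for every derivative with finitely many exceptional points
  (\<open>improper_fundamental_theorem_zero\<close>).

  Conversely, every differentiable \<open>\<phi>\<close> with compact support in \<open>I\<close> has the form \<open>f p\<close> with \<open>f\<close> in the
  Stein class, so the identity says that \<open>\<phi>'\<close> is orthogonal to \<open>h = q / p\<close>. As in the du Bois-Reymond
  lemma this makes \<open>h\<close> constant: if \<open>h u > m > h v\<close>, let \<open>\<phi>'\<close> be a narrow positive bump at \<open>u\<close> minus the
  same bump at \<open>v\<close>; then \<open>\<phi>'\<close> is orthogonal to constants as well, and \<open>\<phi>' (h - m)\<close> is nonnegative and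
  nonzero with integral zero (\<open>two_point_comparison\<close>).

  The comparison needs \<open>h\<close> to be continuous, and \<open>q\<close> may jump at an endpoint of its own support. But
  such an endpoint inside \<open>I\<close> would have points with \<open>h > 0\<close> on one side of it and points with \<open>h = 0\<close>
  on the other, all of them points of continuity, against the constancy of \<open>h\<close> there
  (\<open>stein_identity_imp_proportional\<close>). So \<open>q = c p\<close> on \<open>I\<close>, and since \<open>p\<close> has total mass one,
  integrating over the closure of \<open>I\<close> identifies \<open>c\<close>.
\<close>

section \<open>Improper fundamental theorem\<close>

text \<open>
  The support may or may not contain its endpoints. Passing to the interior of its closure removes the
  ambiguity, since a convex set and its closure have the same interior.
\<close>

lemma interior_density_support:
  assumes "is_interval (density_support p)" "support_endpoints p a b"
  shows "interior (density_support p) = {x. a < ereal x \<and> ereal x < b}"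
proof -
  let ?C = "{x. a \<le> ereal x \<and> ereal x \<le> b}"
  have "interior (density_support p) = interior ?C"
    using assms convex_interior_closure[of "density_support p"]
    by (simp add: is_interval_convex support_endpoints_def)
  also have "\<dots> = {x. a < ereal x \<and> ereal x < b}"
  proof (rule interior_unique)
    show "open {x. a < ereal x \<and> ereal x < b}"
      by (intro open_Collect_conj open_Collect_less continuous_intros)
    fix T assume T: "T \<subseteq> ?C" "open T"
    show "T \<subseteq> {x. a < ereal x \<and> ereal x < b}"
    proof
      fix x assume "x \<in> T"
      with T(2) obtain e where e: "e > 0" "ball x e \<subseteq> T"
        by (auto simp: open_contains_ball)
      have "x - e/2 \<in> T" "x + e/2 \<in> T"
        using e by (auto intro!: subsetD[OF e(2)] simp: dist_real_def)
      with T(1) have "a \<le> ereal (x - e/2)" "ereal (x + e/2) \<le> b"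
        by auto
      moreover have "ereal (x - e/2) < ereal x" "ereal x < ereal (x + e/2)"
        using e(1) by auto
      ultimately show "x \<in> {x. a < ereal x \<and> ereal x < b}"
        unfolding mem_Collect_eq by (meson le_less_trans less_le_trans)
    qed
  qed auto
  finally show ?thesis .
qed

text \<open>
  The boundary condition at an end of \<open>(a, b)\<close> has a double meaning: at an infinite end it is a limit
  at infinity, at a finite end it is continuity of the extension by zero. In the latter case the
  extension also vanishes near the corresponding infinity, so the limit there is zero in both cases.
\<close>

lemma tendsto_zero_extension_left_end:
  fixes F :: "real \<Rightarrow> real"
  assumes ab: "a < b" and lim: "((F \<circ> real_of_ereal) \<longlongrightarrow> 0) (at_right a)"
  defines "G \<equiv> \<lambda>x. if a < ereal x \<and> ereal x < b then F x else 0"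
  shows "(G \<longlongrightarrow> 0) at_bot" and "a = ereal x \<Longrightarrow> isCont G x"
proof -
  show "(G \<longlongrightarrow> 0) at_bot"
  proof (cases "a = -\<infinity>")
    case True
    then have "(F \<longlongrightarrow> 0) at_bot"
      using lim by (simp add: ereal_tendsto_simps1)
    moreover obtain c where "ereal c < b"
      using ereal_dense2[OF ab] by blast
    then have "\<forall>\<^sub>F x in at_bot. F x = G x"
      unfolding eventually_at_bot_linorder G_def
      using True by (metis MInfty_neq_ereal(1) ereal_infty_less(2) ereal_less_eq(3) le_less_trans)
    ultimately show ?thesis
      by (rule Lim_transform_eventually)
  next
    case False
    then obtain c where "ereal c < a"
      by (metis ereal_dense2 ereal_infty_less(2))
    then have "\<forall>\<^sub>F x in at_bot. G x = 0"
      unfolding eventually_at_bot_linorder G_def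
      by (metis ereal_less_eq(3) le_less_trans not_less_iff_gr_or_eq)
    then show ?thesis
      by (rule tendsto_eventually)
  qed
next
  assume a: "a = ereal x"
  have "(G \<longlongrightarrow> 0) (at_right x)"
  proof (rule Lim_transform_eventually)
    show "(F \<longlongrightarrow> 0) (at_right x)"
      using lim by (simp add: a ereal_tendsto_simps1)
    obtain c where c: "x < c" "ereal c < b"
      using ereal_dense2[OF ab] a by auto
    then show "\<forall>\<^sub>F y in at_right x. F y = G y"
      unfolding eventually_at_right_field G_def a
      by (intro exI[of _ c]) (auto intro: less_trans[of _ "ereal c"])
  qed
  moreover have "(G \<longlongrightarrow> 0) (at_left x)"
    by (rule tendsto_eventually) (auto simp: G_def a eventually_at_filter)
  moreover have "G x = 0"
    by (simp add: G_def a)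
  ultimately show "isCont G x"
    by (simp add: isCont_def filterlim_at_split)
qed

lemma tendsto_zero_extension_right_end:
  fixes F :: "real \<Rightarrow> real"
  assumes ab: "a < b" and lim: "((F \<circ> real_of_ereal) \<longlongrightarrow> 0) (at_left b)"
  defines "G \<equiv> \<lambda>x. if a < ereal x \<and> ereal x < b then F x else 0"
  shows "(G \<longlongrightarrow> 0) at_top" and "b = ereal x \<Longrightarrow> isCont G x"
proof -
  show "(G \<longlongrightarrow> 0) at_top"
  proof (cases "b = \<infinity>")
    case True
    then have "(F \<longlongrightarrow> 0) at_top"
      using lim by (simp add: ereal_tendsto_simps1)
    moreover obtain c where "a < ereal c"
      using ereal_dense2[OF ab] by blast
    then have "\<forall>\<^sub>F x in at_top. F x = G x"
      unfolding eventually_at_top_linorder G_def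
      using True by (metis PInfty_neq_ereal(1) ereal_infty_less(1) ereal_less_eq(3) less_le_trans)
    ultimately show ?thesis
      by (rule Lim_transform_eventually)
  next
    case False
    then obtain c where "b < ereal c"
      by (metis ereal_dense2 ereal_infty_less(1))
    then have "\<forall>\<^sub>F x in at_top. G x = 0"
      unfolding eventually_at_top_linorder G_def
      by (metis ereal_less_eq(3) less_le_trans not_less_iff_gr_or_eq)
    then show ?thesis
      by (rule tendsto_eventually)
  qed
next
  assume b: "b = ereal x"
  have "(G \<longlongrightarrow> 0) (at_left x)"
  proof (rule Lim_transform_eventually)
    show "(F \<longlongrightarrow> 0) (at_left x)"
      using lim by (simp add: b ereal_tendsto_simps1)
    obtain c where c: "c < x" "a < ereal c"
      using ereal_dense2[OF ab] b by auto
    then show "\<forall>\<^sub>F y in at_left x. F y = G y"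
      unfolding eventually_at_left_field G_def b
      by (intro exI[of _ c]) (auto intro: less_trans[of _ "ereal c"])
  qed
  moreover have "(G \<longlongrightarrow> 0) (at_right x)"
    by (rule tendsto_eventually) (auto simp: G_def b eventually_at_filter)
  moreover have "G x = 0"
    by (simp add: G_def b)
  ultimately show "isCont G x"
    by (simp add: isCont_def filterlim_at_split)
qed

text \<open>
  On the whole line the gauge integral is the limit of the integrals over compact intervals, and the
  integral over \<open>[c, d]\<close> is \<open>G d - G c\<close>,
  which vanishes in the limit. The finite set \<open>E\<close> leaves room for the corners that the extension by
  zero has at finite ends.
\<close>

lemma has_integral_UNIV_of_antiderivative:
  fixes G g :: "real \<Rightarrow> real"
  assumes "finite E" and cont: "continuous_on UNIV G"
    and deriv: "\<And>x. x \<notin> E \<Longrightarrow> (G has_real_derivative g x) (at x)"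
    and bot: "(G \<longlongrightarrow> 0) at_bot" and top: "(G \<longlongrightarrow> 0) at_top"
  shows "(g has_integral 0) UNIV"
proof -
  have "\<exists>B>0. \<forall>c d. ball 0 B \<subseteq> cbox c d \<longrightarrow>
      (\<exists>z. (g has_integral z) (cbox c d) \<and> \<bar>z\<bar> < e)" if "e > 0" for e
  proof -
    obtain L where L: "\<And>x. x \<le> L \<Longrightarrow> \<bar>G x\<bar> < e/2"
      using tendstoD[OF bot, of "e/2"] \<open>e > 0\<close>
      by (auto simp: eventually_at_bot_linorder)
    obtain R where R: "\<And>x. x \<ge> R \<Longrightarrow> \<bar>G x\<bar> < e/2"
      using tendstoD[OF top, of "e/2"] \<open>e > 0\<close>
      by (auto simp: eventually_at_top_linorder)
    define B where "B = \<bar>L\<bar> + \<bar>R\<bar> + 1"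
    have "(g has_integral (G d - G c)) (cbox c d) \<and> \<bar>G d - G c\<bar> < e"
      if sub: "ball 0 B \<subseteq> cbox c d" for c d
    proof -
      have "\<bar>L\<bar> + \<bar>R\<bar> \<in> ball 0 B" "- (\<bar>L\<bar> + \<bar>R\<bar>) \<in> ball 0 B"
        by (auto simp: B_def)
      then have cd: "c \<le> - (\<bar>L\<bar> + \<bar>R\<bar>)" "\<bar>L\<bar> + \<bar>R\<bar> \<le> d"
        using sub by fastforce+
      have "(g has_integral (G d - G c)) {c..d}"
        using cd \<open>finite E\<close> cont deriv
        by (intro fundamental_theorem_of_calculus_interior_strong[of E])
          (auto simp: has_real_derivative_iff_has_vector_derivative intro: continuous_on_subset)
      moreover have "\<bar>G c\<bar> < e/2" "\<bar>G d\<bar> < e/2"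
        using cd by (intro L R; linarith)+
      ultimately show ?thesis
        by (auto simp: cbox_interval)
    qed
    moreover have "B > 0"
      by (simp add: B_def)
    ultimately show ?thesis
      by blast
  qed
  then show ?thesis
    by (subst has_integral') simp
qed

lemma improper_fundamental_theorem_zero:
  fixes F F' :: "real \<Rightarrow> real" and a b :: ereal
  assumes ab: "a < b"
    and deriv: "\<And>x. \<lbrakk>a < ereal x; ereal x < b\<rbrakk> \<Longrightarrow> (F has_real_derivative F' x) (at x)"
    and lim: "((F \<circ> real_of_ereal) \<longlongrightarrow> 0) (at_right a)"
      "((F \<circ> real_of_ereal) \<longlongrightarrow> 0) (at_left b)"
  shows "(F' has_integral 0) {x. a < ereal x \<and> ereal x < b}"
proof -
  define I where "I = {x. a < ereal x \<and> ereal x < b}"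
  define G where "G = (\<lambda>x. if a < ereal x \<and> ereal x < b then F x else 0)"
  define g where "g = (\<lambda>x. if x \<in> I then F' x else 0)"
  \<comment> \<open>An infinite end contributes the junk value 0 to \<open>E\<close>, which is harmless.\<close>
  define E where "E = {real_of_ereal a, real_of_ereal b}"
  have "open I"
    unfolding I_def by (intro open_Collect_conj open_Collect_less continuous_intros)
  have derG: "(G has_real_derivative g x) (at x)" if "a \<noteq> ereal x" "b \<noteq> ereal x" for x
  proof (cases "x \<in> I")
    case True
    have "(F has_real_derivative g x) (at x)"
      using True deriv by (simp add: g_def I_def)
    then show ?thesis
      by (rule has_field_derivative_transform_within_open[OF _ \<open>open I\<close> True])
        (simp add: G_def I_def)
  next
    case False
    have "open {x. ereal x < a \<or> b < ereal x}"
      by (intro open_Collect_disj open_Collect_less continuous_intros)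
    moreover have "x \<in> {x. ereal x < a \<or> b < ereal x}"
      using False that by (auto simp: I_def)
    moreover have "((\<lambda>_. 0) has_real_derivative g x) (at x)"
      using False by (simp add: g_def)
    moreover have "0 = G y" if "y \<in> {x. ereal x < a \<or> b < ereal x}" for y
      using that by (auto simp: G_def)
    ultimately show ?thesis
      by (metis (no_types, lifting) has_field_derivative_transform_within_open)
  qed
  have "isCont G x" for x
    using tendsto_zero_extension_left_end(2)[OF ab lim(1), of x]
      tendsto_zero_extension_right_end(2)[OF ab lim(2), of x] derG[of x]
    unfolding G_def by (metis (mono_tags, lifting) DERIV_isCont)
  then have "continuous_on UNIV G"
    by (simp add: continuous_on_eq_continuous_at)
  moreover have "(G has_real_derivative g x) (at x)" if "x \<notin> E" for x
    using that by (intro derG) (auto simp: E_def)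
  ultimately have "(g has_integral 0) UNIV"
    using tendsto_zero_extension_left_end(1)[OF ab lim(1)]
      tendsto_zero_extension_right_end(1)[OF ab lim(2)]
    by (intro has_integral_UNIV_of_antiderivative[of E G]) (auto simp: E_def G_def)
  then show ?thesis
    unfolding g_def has_integral_restrict_UNIV I_def .
qed

section \<open>Bump test functions\<close>

text \<open>
  The test functions only need to be differentiable with a continuous derivative, so piecewise quadratic
  ones suffice. The tent is half the second difference of \<open>2 max 0 t\<close>, the derivative of
  \<open>(max 0 t)\<^sup>2\<close>; its primitive is therefore half the second difference of \<open>(max 0 t)\<^sup>2\<close>.
\<close>

definition tent :: "real \<Rightarrow> real" where
  "tent t = max 0 (1 - \<bar>t\<bar>)"

definition tent_primitive :: "real \<Rightarrow> real" where
  "tent_primitive t = ((max 0 (t + 1))\<^sup>2 - 2 * (max 0 t)\<^sup>2 + (max 0 (t - 1))\<^sup>2) / 2"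

lemma DERIV_square_positive_part:
  "((\<lambda>t::real. (max 0 t)\<^sup>2) has_real_derivative 2 * max 0 t) (at t)"
proof -
  consider "t < 0" | "t > 0" | "t = 0"
    by linarith
  then show ?thesis
  proof cases
    case 1
    have "((\<lambda>_. 0) has_real_derivative 2 * max 0 t) (at t)"
      using 1 by simp
    then show ?thesis
      by (rule has_field_derivative_transform_within_open[of _ _ _ "{..<0}"]) (use 1 in auto)
  next
    case 2
    have "((\<lambda>t. t\<^sup>2) has_real_derivative 2 * max 0 t) (at t)"
      using 2 by (auto intro!: derivative_eq_intros)
    then show ?thesis
      by (rule has_field_derivative_transform_within_open[of _ _ _ "{0<..}"]) (use 2 in auto)
  next
    case 3
    have "((\<lambda>h::real. (max 0 h)\<^sup>2 / h) \<longlongrightarrow> 0) (at 0)"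
    proof (rule Lim_null_comparison)
      show "\<forall>\<^sub>F h::real in at 0. norm ((max 0 h)\<^sup>2 / h) \<le> \<bar>h\<bar>"
        by (rule always_eventually) (auto simp: max_def power2_eq_square)
    qed (auto intro!: tendsto_eq_intros)
    then show ?thesis
      by (simp add: 3 DERIV_def)
  qed
qed

lemma DERIV_tent_primitive: "(tent_primitive has_real_derivative tent t) (at t)"
proof -
  note [derivative_intros] = DERIV_chain2[OF DERIV_square_positive_part]
  have "(tent_primitive has_real_derivative
      (2 * max 0 (t + 1) - 2 * (2 * max 0 t) + 2 * max 0 (t - 1)) / 2) (at t)"
    unfolding tent_primitive_def[abs_def] by (auto intro!: derivative_eq_intros)
  moreover have "(2 * max 0 (t + 1) - 2 * (2 * max 0 t) + 2 * max 0 (t - 1)) / 2 = tent t"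
    by (auto simp: tent_def max_def)
  ultimately show ?thesis
    by simp
qed

lemma tent_primitive_outside: "t \<le> -1 \<Longrightarrow> tent_primitive t = 0" "t \<ge> 1 \<Longrightarrow> tent_primitive t = 1"
  by (auto simp: tent_primitive_def max_def power2_eq_square algebra_simps)

section \<open>A du Bois-Reymond lemma\<close>

text \<open>
  The set \<open>C\<close> is where \<open>h\<close> is known to be continuous. The bumps live near \<open>u\<close> and \<open>v\<close>, inside \<open>C\<close>, but
  the test function \<open>\<phi>\<close> is a plateau between them, so its support has to fit into the interval \<open>I\<close> only.
\<close>

lemma two_point_comparison:
  fixes h :: "real \<Rightarrow> real"
  assumes I: "open I" "is_interval I"
    and C: "open C" "C \<subseteq> I" "continuous_on C h" "u \<in> C" "v \<in> C"
    and orth: "\<And>\<phi> g l r. \<lbrakk>l \<in> I; r \<in> I; \<And>t. (\<phi> has_real_derivative g t) (at t);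
        \<And>t. t \<notin> {l<..<r} \<Longrightarrow> \<phi> t = 0 \<and> g t = 0\<rbrakk>
        \<Longrightarrow> ((\<lambda>t. g t * h t) has_integral 0) UNIV"
  shows "h u \<le> h v"
proof (rule ccontr)
  assume "\<not> h u \<le> h v"
  then obtain m where m: "h v < m" "m < h u"
    using dense by (metis not_le)
  have "open (C \<inter> h -` {m<..})" "open (C \<inter> h -` {..<m})"
    using C by (auto intro: continuous_open_preimage)
  moreover have "u \<in> C \<inter> h -` {m<..}" "v \<in> C \<inter> h -` {..<m}"
    using C m by auto
  ultimately obtain d1 d2 where d: "d1 > 0" "cball u d1 \<subseteq> C \<inter> h -` {m<..}"
      "d2 > 0" "cball v d2 \<subseteq> C \<inter> h -` {..<m}"
    by (meson open_contains_cball)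
  define d where "d = min d1 d2"
  have d0: "d > 0" using d by (simp add: d_def)
  have du: "t \<in> C \<and> m < h t" if "\<bar>t - u\<bar> \<le> d" for t
    using that subsetD[OF d(2), of t] by (auto simp: d_def dist_real_def abs_minus_commute)
  have dv: "t \<in> C \<and> h t < m" if "\<bar>t - v\<bar> \<le> d" for t
    using that subsetD[OF d(4), of t] by (auto simp: d_def dist_real_def abs_minus_commute)
  define \<phi> where "\<phi> = (\<lambda>t. tent_primitive ((t - u) / d) - tent_primitive ((t - v) / d))"
  define g where "g = (\<lambda>t. (tent ((t - u) / d) - tent ((t - v) / d)) / d)"
  define l where "l = min u v - d"
  define r where "r = max u v + d"
  have lr: "l \<in> I" "r \<in> I" "l \<le> r"
    using du[of "u - d"] dv[of "v - d"] du[of "u + d"] dv[of "v + d"] C(2) d0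
    by (auto simp: l_def r_def min_def max_def)
  have der: "(\<phi> has_real_derivative g t) (at t)" for t
  proof -
    note [derivative_intros] = DERIV_chain2[OF DERIV_tent_primitive]
    show ?thesis
      unfolding \<phi>_def g_def using d0
      by (auto intro!: derivative_eq_intros simp: field_simps)
  qed
  have tent0: "tent ((t - w) / d) = 0" if "d \<le> \<bar>t - w\<bar>" for t w
    using that d0 by (simp add: tent_def)
  have out: "\<phi> t = 0 \<and> g t = 0" if "t \<notin> {l<..<r}" for t
  proof -
    consider "t - u \<le> - d" "t - v \<le> - d" | "t - u \<ge> d" "t - v \<ge> d"
      using \<open>t \<notin> _\<close> by (fastforce simp: l_def r_def)
    then show ?thesis
    proof cases
      case 1
      then have "(t - u) / d \<le> -1" "(t - v) / d \<le> -1"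
        using d0 by (auto simp: field_simps)
      with 1 show ?thesis
        using d0 by (simp add: \<phi>_def g_def tent_primitive_outside tent0)
    next
      case 2
      then have "(t - u) / d \<ge> 1" "(t - v) / d \<ge> 1"
        using d0 by (auto simp: field_simps)
      with 2 show ?thesis
        using d0 by (simp add: \<phi>_def g_def tent_primitive_outside tent0)
    qed
  qed
  \<comment> \<open>Both \<open>h\<close> and the constant \<open>m\<close> are orthogonal to \<open>g\<close>.\<close>
  have "((\<lambda>t. g t * h t) has_integral 0) UNIV"
    by (rule orth[OF lr(1,2) der out])
  moreover have "(g has_integral 0) UNIV"
  proof (rule has_integral_on_superset)
    have "(g has_integral (\<phi> r - \<phi> l)) {l..r}"
      using lr(3) der
      by (intro fundamental_theorem_of_calculus)
        (auto simp: has_real_derivative_iff_has_vector_derivative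
          intro: has_vector_derivative_at_within)
    then show "(g has_integral 0) {l..r}"
      using out[of l] out[of r] by simp
  qed (use out in auto)
  ultimately have "((\<lambda>t. g t * h t - m * g t) has_integral (0 - m * 0)) UNIV"
    by (intro has_integral_diff has_integral_mult_right)
  then have int: "((\<lambda>t. g t * (h t - m)) has_integral 0) UNIV"
    by (simp add: algebra_simps)
  \<comment> \<open>The bumps do not overlap, because \<open>h > m\<close> under the first and \<open>h < m\<close> under the second.\<close>
  have nonneg: "0 \<le> g t * (h t - m)" for t
  proof -
    have tent_nonneg: "0 \<le> tent s" for s
      by (simp add: tent_def)
    consider "\<bar>t - u\<bar> \<le> d" "d \<le> \<bar>t - v\<bar>" | "\<bar>t - v\<bar> \<le> d" "d \<le> \<bar>t - u\<bar>"
      | "d \<le> \<bar>t - u\<bar>" "d \<le> \<bar>t - v\<bar>"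
      using du[of t] dv[of t] by linarith
    then show ?thesis
    proof cases
      case 1
      then have "0 \<le> g t" "m < h t"
        using du tent0[of t v] tent_nonneg d0 by (auto simp: g_def)
      then show ?thesis
        by simp
    next
      case 2
      then have "g t \<le> 0" "h t < m"
        using dv tent0[of t u] tent_nonneg d0 by (auto simp: g_def)
      then show ?thesis
        by (simp add: mult_nonpos_nonpos)
    next
      case 3
      then show ?thesis
        by (simp add: g_def tent0)
    qed
  qed
  let ?J = "cbox (u - d) (u + d)"
  let ?k = "\<lambda>t. g t * (h t - m)"
  have intJ: "?k integrable_on ?J"
    using int by (meson has_integral_integrable integrable_on_subcbox subset_UNIV)
  have "integral ?J ?k \<le> 0"
    using intJ int nonneg by (intro has_integral_subset_le[of ?J UNIV ?k]) (auto simp: integrable_integral)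
  moreover have "0 \<le> integral ?J ?k"
    using intJ nonneg by (intro integral_nonneg) auto
  ultimately have int0: "(?k has_integral 0) ?J"
    using intJ by (metis antisym integrable_integral)
  have "continuous_on ?J ?k"
  proof -
    have "continuous_on ?J h"
      by (rule continuous_on_subset[OF C(3)]) (use du in \<open>auto simp: abs_le_iff\<close>)
    moreover have "continuous_on ?J g"
      unfolding g_def tent_def using d0 by (intro continuous_intros) auto
    ultimately show ?thesis
      by (intro continuous_intros)
  qed
  from has_integral_0_cbox_imp_0[OF this nonneg int0, of u] d0
  have "?k u = 0"
    by (auto simp: box_real)
  moreover have "d \<le> \<bar>u - v\<bar>"
    using du[of u] dv[of u] d0 by force
  then have "g u = 1 / d"
    using tent0[of u v] by (simp add: g_def tent_def)
  ultimately show False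
    using d0 m by simp
qed

section \<open>Stein characterization\<close>

text \<open>
  Compact support makes both boundary conditions trivial and keeps \<open>\<phi>\<close> away from the zeros of \<open>p\<close>, so
  \<open>\<phi> / p\<close> is a legitimate test function, and the Stein identity for it is orthogonality of \<open>\<phi>'\<close>
  and \<open>q / p\<close>.
\<close>

lemma compactly_supported_quotient_in_stein_class:
  assumes iv: "is_interval (density_support p)" and ab: "support_endpoints p a b"
    and lr: "l \<in> interior (density_support p)" "r \<in> interior (density_support p)"
    and der: "\<And>t. (\<phi> has_real_derivative g t) (at t)"
    and out: "\<And>t. t \<notin> {l<..<r} \<Longrightarrow> \<phi> t = 0 \<and> g t = 0"
  shows "(\<lambda>y. \<phi> y / p y) \<in> stein_class p"
    and "stein_operator p (\<lambda>y. \<phi> y / p y) t * q t = g t * (q t / p t)"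
proof -
  have I: "interior (density_support p) = {x. a < ereal x \<and> ereal x < b}"
    by (rule interior_density_support[OF iv ab])
  have "\<phi> y / p y * p y = \<phi> y" for y
  proof (cases "y \<in> {l<..<r}")
    case True
    then have "a < ereal y" "ereal y < b"
      using lr less_trans[of a "ereal l" "ereal y"] less_trans[of "ereal y" "ereal r" b]
      by (auto simp: I)
    then have "y \<in> density_support p"
      using I interior_subset by blast
    then show ?thesis
      by (simp add: density_support_def)
  qed (simp add: out)
  then have eq: "(\<lambda>y. \<phi> y / p y * p y) = \<phi>"
    by blast
  have la: "a < ereal l" and rb: "ereal r < b"
    using lr by (auto simp: I)
  have "((\<phi> \<circ> real_of_ereal) \<longlongrightarrow> 0) (at_right a)"
  proof (rule tendsto_eventually)
    have "\<phi> (real_of_ereal x) = 0" if "a < x" "x < ereal l" for x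
      using that out by (cases x) auto
    then show "\<forall>\<^sub>F x in at_right a. (\<phi> \<circ> real_of_ereal) x = 0"
      using la by (auto simp: eventually_at_right[OF la])
  qed
  moreover have "((\<phi> \<circ> real_of_ereal) \<longlongrightarrow> 0) (at_left b)"
  proof (rule tendsto_eventually)
    have "\<phi> (real_of_ereal x) = 0" if "ereal r < x" "x < b" for x
      using that out by (cases x) auto
    then show "\<forall>\<^sub>F x in at_left b. (\<phi> \<circ> real_of_ereal) x = 0"
      using rb by (auto simp: eventually_at_left[OF rb])
  qed
  ultimately show "(\<lambda>y. \<phi> y / p y) \<in> stein_class p"
    using ab der unfolding stein_class_def mem_Collect_eq eq real_differentiable_def by blast
  show "stein_operator p (\<lambda>y. \<phi> y / p y) t * q t = g t * (q t / p t)"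
    unfolding stein_operator_def eq DERIV_imp_deriv[OF der] by simp
qed

lemma density_classD:
  assumes "p \<in> density_class"
  shows "0 \<le> p x" "is_interval (density_support p)" "(p has_integral 1) (density_support p)"
    "x \<in> interior (density_support p) \<Longrightarrow> p differentiable (at x)"
    "x \<in> interior (density_support p) \<Longrightarrow> 0 < p x"
    "interior (density_support p) \<noteq> {}"
    "negligible (frontier (density_support p))"
    "x \<notin> density_support p \<Longrightarrow> p x = 0"
proof -
  obtain a b where ab: "support_endpoints p a b"
    and diff: "\<forall>x. a < ereal x \<and> ereal x < b \<longrightarrow> p differentiable (at x)"
    using assms by (auto simp: density_class_def)
  show iv: "is_interval (density_support p)"
    using assms by (simp add: density_class_def)
  note I = interior_density_support[OF iv ab]
  show "0 \<le> p x" "(p has_integral 1) (density_support p)"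
    using assms by (auto simp: density_class_def)
  show "x \<notin> density_support p \<Longrightarrow> p x = 0"
    using assms by (auto simp: density_class_def density_support_def antisym not_less)
  show "x \<in> interior (density_support p) \<Longrightarrow> p differentiable (at x)"
    using diff by (simp add: I)
  show "x \<in> interior (density_support p) \<Longrightarrow> 0 < p x"
    using interior_subset by (force simp: density_support_def)
  obtain c where "a < ereal c" "ereal c < b"
    using ab ereal_dense2[of a b] by (auto simp: support_endpoints_def)
  then show "interior (density_support p) \<noteq> {}"
    unfolding I by blast
  show "negligible (frontier (density_support p))"
    using iv by (intro negligible_convex_frontier) (simp add: is_interval_convex)
qed

lemma continuous_off_frontier_of_support:
  assumes "q \<in> density_class"
  shows "continuous_on (- frontier (density_support q)) q"
proof -
  note q = density_classD[OF assms]
  have "isCont q x" if "x \<notin> frontier (density_support q)" for x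
  proof (cases "x \<in> interior (density_support q)")
    case True
    then show ?thesis
      using q(4) by (simp add: differentiable_imp_continuous_within)
  next
    case False
    then have x: "x \<in> - closure (density_support q)"
      using that by (simp add: frontier_def)
    have "q y = 0" if "y \<in> - closure (density_support q)" for y
      using that q(8)[of y] closure_subset[of "density_support q"] by blast
    then have "continuous_on (- closure (density_support q)) q"
      by (subst continuous_on_cong[where g="\<lambda>_. 0"]) auto
    then show ?thesis
      using x by (simp add: continuous_on_eq_continuous_at open_Compl)
  qed
  then show ?thesis
    by (simp add: continuous_at_imp_continuous_on)
qed

text \<open>
  For a nondegenerate interval, the interior and the exterior both accumulate at each frontier point:
  a convex set with nonempty interior lies in the closure of that interior, and has the same interior
  as its closure.
\<close>

lemma frontier_meets_both_sides:
  fixes S U :: "real set"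
  assumes "is_interval S" "interior S \<noteq> {}" "open U" "x \<in> U" "x \<in> frontier S"
  obtains u v where "u \<in> U \<inter> interior S" "v \<in> U - closure S"
proof -
  have "convex S"
    using assms(1) by (simp add: is_interval_convex)
  have "x \<in> closure (interior S)"
    using assms(5) convex_closure_interior[OF \<open>convex S\<close> assms(2)] by (simp add: frontier_def)
  then obtain u where "u \<in> U \<inter> interior S"
    using assms(3,4) open_Int_closure_eq_empty by blast
  moreover have "x \<in> closure (- closure S)"
    using assms(5) convex_interior_closure[OF \<open>convex S\<close>]
    by (simp add: frontier_def closure_complement)
  then obtain v where "v \<in> U - closure S"
    using assms(3,4) open_Int_closure_eq_empty by blast
  ultimately show ?thesis
    by (rule that)
qed

lemma stein_identity_imp_proportional:
  assumes p: "p \<in> density_class" and q: "q \<in> density_class"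
    and stein: "\<And>f. f \<in> stein_class p \<Longrightarrow>
      ((\<lambda>y. stein_operator p f y * q y) has_integral 0) UNIV"
  obtains c where "\<And>x. x \<in> interior (density_support p) \<Longrightarrow> q x = p x * c"
proof -
  define I where "I = interior (density_support p)"
  define C where "C = I - frontier (density_support q)"
  define h where "h = (\<lambda>x. q x / p x)"
  note P = density_classD[OF p] and Q = density_classD[OF q]
  obtain a b where ab: "support_endpoints p a b"
    using p by (auto simp: density_class_def)
  have "is_interval I"
    unfolding I_def using P(2) by (simp add: is_interval_convex_1)
  have "open I" "open C" "C \<subseteq> I"
    by (auto simp: I_def C_def open_Diff)
  have "continuous_on I p"
    unfolding I_def using P(4)
    by (intro continuous_at_imp_continuous_on ballI differentiable_imp_continuous_within)
  then have "continuous_on C h"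
    unfolding h_def using P(5) continuous_off_frontier_of_support[OF q]
    by (intro continuous_on_divide) (force simp: C_def I_def intro: continuous_on_subset)+
  have le: "h u \<le> h v" if "u \<in> C" "v \<in> C" for u v
  proof (rule two_point_comparison[OF \<open>open I\<close> \<open>is_interval I\<close> \<open>open C\<close> \<open>C \<subseteq> I\<close> \<open>continuous_on C h\<close> that])
    fix \<phi> g l r
    assume *: "l \<in> I" "r \<in> I" "\<And>t. (\<phi> has_real_derivative g t) (at t)"
      "\<And>t. t \<notin> {l<..<r} \<Longrightarrow> \<phi> t = 0 \<and> g t = 0"
    note quot = compactly_supported_quotient_in_stein_class
      [OF P(2) ab *(1)[unfolded I_def] *(2)[unfolded I_def] *(3)]
    have "(\<lambda>y. \<phi> y / p y) \<in> stein_class p"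
      by (rule quot(1)) (use *(4) in auto)
    moreover have "stein_operator p (\<lambda>y. \<phi> y / p y) t * q t = g t * h t" for t
      unfolding h_def by (rule quot(2)) (use *(4) in auto)
    ultimately show "((\<lambda>t. g t * h t) has_integral 0) UNIV"
      using stein by fastforce
  qed
  \<comment> \<open>An endpoint of the support of \<open>q\<close> inside \<open>I\<close> would separate points with \<open>h > 0\<close> and \<open>h = 0\<close>.\<close>
  have "C = I"
  proof (rule ccontr)
    assume "C \<noteq> I"
    then obtain x where "x \<in> I" "x \<in> frontier (density_support q)"
      by (auto simp: C_def)
    then obtain u v where u: "u \<in> I \<inter> interior (density_support q)"
      and v: "v \<in> I - closure (density_support q)"
      using frontier_meets_both_sides[OF Q(2) Q(6) \<open>open I\<close>] by metis
    then have "h u \<le> h v"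
      by (intro le) (auto simp: C_def frontier_def)
    moreover have "q v = 0"
      using v Q(8)[of v] closure_subset[of "density_support q"] by blast
    moreover have "0 < q u" "0 < p u"
      using u P(5) Q(5) by (auto simp: I_def)
    ultimately show False
      by (auto simp: h_def divide_le_0_iff)
  qed
  obtain w where "w \<in> I"
    using P(6) by (auto simp: I_def)
  have "q x = p x * h w" if "x \<in> I" for x
  proof -
    have "h x = h w"
      using le that \<open>w \<in> I\<close> \<open>C = I\<close> by (simp add: antisym)
    then show ?thesis
      using P(5)[of x] that by (auto simp: h_def I_def field_simps)
  qed
  then show ?thesis
    unfolding I_def by (rule that)
qed

text \<open>
  Since \<open>p\<close> has total mass one, the factor is the mass that \<open>q\<close> puts on the support of \<open>p\<close>; the
  endpoints form a null set and do not affect it.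
\<close>

lemma proportionality_constant:
  assumes p: "p \<in> density_class" and ratio: "\<And>x. x \<in> interior (density_support p) \<Longrightarrow> q x = p x * c"
  shows "(q has_integral c) (closure (density_support p))"
proof -
  have "((\<lambda>x. p x * c) has_integral 1 * c) (density_support p)"
    using density_classD(3)[OF p] by (rule has_integral_mult_left)
  then have "((\<lambda>x. p x * c) has_integral 1 * c) (closure (density_support p))"
    using closure_subset[of "density_support p"] interior_subset[of "density_support p"]
    by (subst has_integral_spike_set_eq[where T="density_support p"])
      (auto intro!: negligible_subset[OF density_classD(7)[OF p]] simp: frontier_def)
  then show ?thesis
    using density_classD(7)[OF p] ratio
    by (intro has_integral_spike[of "frontier (density_support p)" _ q "\<lambda>x. p x * c"])
      (auto simp: frontier_def)
qed

text \<open>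
  The operator carries the factor \<open>1 / p\<close>, which \<open>q = c p\<close> cancels, leaving \<open>c (f p)'\<close> on the interior;
  off the closed support the factor is zero by convention.
\<close>

lemma proportional_imp_stein_identity:
  assumes p: "p \<in> density_class" and f: "f \<in> stein_class p"
    and ratio: "\<And>x. x \<in> interior (density_support p) \<Longrightarrow> q x = p x * c"
  shows "((\<lambda>y. stein_operator p f y * q y) has_integral 0) UNIV"
proof -
  let ?F = "\<lambda>y. f y * p y" and ?I = "interior (density_support p)"
  note P = density_classD[OF p]
  obtain a b where ab: "support_endpoints p a b"
    and lim: "((?F \<circ> real_of_ereal) \<longlongrightarrow> 0) (at_right a)"
      "((?F \<circ> real_of_ereal) \<longlongrightarrow> 0) (at_left b)"
    using f by (auto simp: stein_class_def)
  note I = interior_density_support[OF P(2) ab]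
  have "(deriv ?F has_integral 0) ?I"
    unfolding I
  proof (rule improper_fundamental_theorem_zero[OF _ _ lim])
    show "a < b"
      using ab by (simp add: support_endpoints_def)
    show "(?F has_real_derivative deriv ?F x) (at x)" if "a < ereal x" "ereal x < b" for x
      using f that by (simp add: stein_class_def I DERIV_deriv_iff_real_differentiable)
  qed
  then have "((\<lambda>y. deriv ?F y * c) has_integral 0) ?I"
    using has_integral_mult_left[of "deriv ?F" 0 ?I c] by simp
  then have "((\<lambda>y. if y \<in> ?I then deriv ?F y * c else 0) has_integral 0) UNIV"
    by (simp only: has_integral_restrict_UNIV)
  then show ?thesis
  proof (rule has_integral_spike[OF P(7), rotated])
    fix y assume y: "y \<in> UNIV - frontier (density_support p)"
    show "stein_operator p f y * q y = (if y \<in> ?I then deriv ?F y * c else 0)"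
    proof (cases "y \<in> ?I")
      case True
      then show ?thesis
        using P(5)[OF True] ratio[OF True] by (simp add: stein_operator_def)
    next
      case False
      then have "y \<notin> density_support p"
        using y closure_subset by (auto simp: frontier_def)
      then have "p y = 0"
        by (rule P(8))
      then show ?thesis
        using False by (simp add: stein_operator_def)
    qed
  qed
qed

theorem theorem2p1:
  fixes p q :: "real \<Rightarrow> real" and a b :: ereal
  assumes "p \<in> density_class" and "q \<in> density_class"
    and "support_endpoints p a b"
  shows "(\<forall>f \<in> stein_class p. ((\<lambda>y. stein_operator p f y * q y) has_integral 0) UNIV) \<longleftrightarrow>
         (\<forall>x \<in> interior (density_support p).
            q x = p x * integral {u. a \<le> ereal u \<and> ereal u \<le> b} q)"
proof
  assume "\<forall>f \<in> stein_class p. ((\<lambda>y. stein_operator p f y * q y) has_integral 0) UNIV"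
  then obtain c where c: "\<And>x. x \<in> interior (density_support p) \<Longrightarrow> q x = p x * c"
    using stein_identity_imp_proportional[OF assms(1,2)] by blast
  have "integral {u. a \<le> ereal u \<and> ereal u \<le> b} q = c"
    using proportionality_constant[OF assms(1) c] assms(3)
    by (simp add: support_endpoints_def integral_unique)
  with c show "\<forall>x \<in> interior (density_support p).
      q x = p x * integral {u. a \<le> ereal u \<and> ereal u \<le> b} q"
    by simp
next
  assume "\<forall>x \<in> interior (density_support p).
      q x = p x * integral {u. a \<le> ereal u \<and> ereal u \<le> b} q"
  then show "\<forall>f \<in> stein_class p. ((\<lambda>y. stein_operator p f y * q y) has_integral 0) UNIV"
    using proportional_imp_stein_identity[OF assms(1)] by blast
qed

end
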